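(* Let $\mathcal{C}$ be a model category and let $\mathcal{C}_{fc}$ be its full subcategory of fibrant-cofibrant objects. In $\mathcal{C}_{fc}$, the relations $\stackrel{\ell}{\sim}$ and $\sim_\ell$ coincide; that is, for parallel arrows $f,g$ of $\mathcal{C}_{fc}$, $f\stackrel{\ell}{\sim}g$ if and only if $f\sim_\ell g$.
   Context: $\stackrel{\ell}{\sim}$ is Quillen's left homotopy relation: for $f,g:A\to B$, $f\stackrel{\ell}{\sim}g$ if and only if there are an object $A\times I$ of $\mathcal{C}$ (a notation, not a product) and arrows $\partial_0,\partial_1:A\to A\times I$, $\sigma:A\times I\to A$, $h:A\times I\to B$ in $\mathcal{C}$ such that $\sigma\partial_0=\sigma\partial_1=id_A$, $h\partial_0=f$, $h\partial_1=g$, $\sigma$ is a weak equivalence and $\partial_0+\partial_1:A\amalg A\to A\times I$ is a cofibration. $\sim_\ell$ is defined in $\mathcal{C}_{fc}$ using only its weak equivalences (the weak equivalences of $\mathcal{C}$ between objects of $\mathcal{C}_{fc}$): for parallel arrows $f,g:A\to B$ of $\mathcal{C}_{fc}$, $f\,R_\ell\,g$ if and only if there is a weak equivalence $\sigma:B\to C$ in $\mathcal{C}_{fc}$ with $\sigma f=\sigma g$; and $\sim_\ell$ is the least congruence in $\mathcal{C}_{fc}$ containing $R_\ell$, where a congruence is a choice of an equivalence relation on each hom-set such that $f\sim g$ implies $vfu\sim vgu$ whenever the compositions make sense. *)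

theory Defs
  imports Main
begin

section \<open>Categories\<close>

record ('o, 'a) cat =
  Obj :: "'o set"
  Arr :: "'a set"
  Dom :: "'a \<Rightarrow> 'o"
  Cod :: "'a \<Rightarrow> 'o"
  Ident :: "'o \<Rightarrow> 'a"
  Comp :: "'a \<Rightarrow> 'a \<Rightarrow> 'a"  (infixl "\<cdot>\<index>" 70)

text \<open>Composition is in the usual order: \<open>g \<cdot>\<^bsub>C\<^esub> f\<close> is \<open>g\<close> after \<open>f\<close>. Its values on
  non-composable pairs are irrelevant.\<close>

definition hom :: "('o, 'a) cat \<Rightarrow> 'o \<Rightarrow> 'o \<Rightarrow> 'a set" where
  "hom C A B = {f \<in> Arr C. Dom C f = A \<and> Cod C f = B}"

locale category =
  fixes C :: "('o, 'a) cat" (structure)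
  assumes Dom_in_Obj: "f \<in> Arr C \<Longrightarrow> Dom C f \<in> Obj C"
    and Cod_in_Obj: "f \<in> Arr C \<Longrightarrow> Cod C f \<in> Obj C"
    and Ident_in_hom: "A \<in> Obj C \<Longrightarrow> Ident C A \<in> hom C A A"
    and Comp_in_hom: "\<lbrakk>f \<in> hom C A B; g \<in> hom C B D\<rbrakk> \<Longrightarrow> g \<cdot> f \<in> hom C A D"
    and Comp_Ident: "f \<in> hom C A B \<Longrightarrow> f \<cdot> Ident C A = f"
    and Ident_Comp: "f \<in> hom C A B \<Longrightarrow> Ident C B \<cdot> f = f"
    and Comp_assoc: "\<lbrakk>f \<in> hom C A B; g \<in> hom C B D; h \<in> hom C D E\<rbrakk> \<Longrightarrow> (h \<cdot> g) \<cdot> f = h \<cdot> (g \<cdot> f)"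

definition opposite :: "('o, 'a) cat \<Rightarrow> ('o, 'a) cat" where
  "opposite C = \<lparr>Obj = Obj C, Arr = Arr C, Dom = Cod C, Cod = Dom C, Ident = Ident C,
     Comp = (\<lambda>g f. f \<cdot>\<^bsub>C\<^esub> g)\<rparr>"

definition full_subcategory :: "('o, 'a) cat \<Rightarrow> 'o set \<Rightarrow> ('o, 'a) cat" where
  "full_subcategory C S =
     C\<lparr>Obj := Obj C \<inter> S, Arr := {f \<in> Arr C. Dom C f \<in> S \<and> Cod C f \<in> S}\<rparr>"

lemma hom_opposite [simp]: "hom (opposite C) A B = hom C B A"
  by (auto simp: hom_def opposite_def)

lemma category_opposite: "category C \<Longrightarrow> category (opposite C)"
  unfolding category_def by (auto simp: opposite_def hom_def)

lemma category_full_subcategory: "category C \<Longrightarrow> category (full_subcategory C S)"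
  unfolding category_def by (auto simp: full_subcategory_def hom_def)

definition is_iso :: "('o, 'a) cat \<Rightarrow> 'a \<Rightarrow> bool" where
  "is_iso C f \<longleftrightarrow> f \<in> Arr C \<and>
     (\<exists>g \<in> hom C (Cod C f) (Dom C f).
        g \<cdot>\<^bsub>C\<^esub> f = Ident C (Dom C f) \<and> f \<cdot>\<^bsub>C\<^esub> g = Ident C (Cod C f))"


section \<open>Limits and colimits\<close>

definition is_functor ::
    "('j, 'u) cat \<Rightarrow> ('o, 'a) cat \<Rightarrow> ('j \<Rightarrow> 'o) \<Rightarrow> ('u \<Rightarrow> 'a) \<Rightarrow> bool" where
  "is_functor J C Fo Fa \<longleftrightarrow>
     (\<forall>j \<in> Obj J. Fo j \<in> Obj C) \<and>
     (\<forall>u \<in> Arr J. Fa u \<in> hom C (Fo (Dom J u)) (Fo (Cod J u))) \<and>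
     (\<forall>j \<in> Obj J. Fa (Ident J j) = Ident C (Fo j)) \<and>
     (\<forall>u \<in> Arr J. \<forall>v \<in> Arr J. Cod J u = Dom J v \<longrightarrow> Fa (v \<cdot>\<^bsub>J\<^esub> u) = Fa v \<cdot>\<^bsub>C\<^esub> Fa u)"

definition is_cone ::
    "('j, 'u) cat \<Rightarrow> ('o, 'a) cat \<Rightarrow> ('j \<Rightarrow> 'o) \<Rightarrow> ('u \<Rightarrow> 'a) \<Rightarrow> 'o \<Rightarrow> ('j \<Rightarrow> 'a) \<Rightarrow> bool" where
  "is_cone J C Fo Fa X p \<longleftrightarrow>
     X \<in> Obj C \<and> (\<forall>j \<in> Obj J. p j \<in> hom C X (Fo j)) \<and>
     (\<forall>u \<in> Arr J. Fa u \<cdot>\<^bsub>C\<^esub> p (Dom J u) = p (Cod J u))"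

definition is_limit ::
    "('j, 'u) cat \<Rightarrow> ('o, 'a) cat \<Rightarrow> ('j \<Rightarrow> 'o) \<Rightarrow> ('u \<Rightarrow> 'a) \<Rightarrow> 'o \<Rightarrow> ('j \<Rightarrow> 'a) \<Rightarrow> bool" where
  "is_limit J C Fo Fa X p \<longleftrightarrow>
     is_cone J C Fo Fa X p \<and>
     (\<forall>Y q. is_cone J C Fo Fa Y q \<longrightarrow> (\<exists>!h. h \<in> hom C Y X \<and> (\<forall>j \<in> Obj J. p j \<cdot>\<^bsub>C\<^esub> h = q j)))"

text \<open>Index categories on subsets of the natural numbers suffice, since every finite category is
  isomorphic to such a one.\<close>

definition has_finite_limits :: "('o, 'a) cat \<Rightarrow> bool" where
  "has_finite_limits C \<longleftrightarrow>
     (\<forall>(J :: (nat, nat) cat) Fo Fa.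
        category J \<and> finite (Obj J) \<and> finite (Arr J) \<and> is_functor J C Fo Fa \<longrightarrow>
        (\<exists>X p. is_limit J C Fo Fa X p))"

definition has_finite_colimits :: "('o, 'a) cat \<Rightarrow> bool" where
  "has_finite_colimits C \<longleftrightarrow> has_finite_limits (opposite C)"

definition is_initial :: "('o, 'a) cat \<Rightarrow> 'o \<Rightarrow> bool" where
  "is_initial C X \<longleftrightarrow> X \<in> Obj C \<and> (\<forall>Y \<in> Obj C. \<exists>!f. f \<in> hom C X Y)"

definition is_terminal :: "('o, 'a) cat \<Rightarrow> 'o \<Rightarrow> bool" where
  "is_terminal C X \<longleftrightarrow> X \<in> Obj C \<and> (\<forall>Y \<in> Obj C. \<exists>!f. f \<in> hom C Y X)"

definition is_coproduct :: "('o, 'a) cat \<Rightarrow> 'o \<Rightarrow> 'o \<Rightarrow> 'o \<Rightarrow> 'a \<Rightarrow> 'a \<Rightarrow> bool" where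
  "is_coproduct C A B P i j \<longleftrightarrow>
     i \<in> hom C A P \<and> j \<in> hom C B P \<and>
     (\<forall>Y. \<forall>f \<in> hom C A Y. \<forall>g \<in> hom C B Y.
        \<exists>!h. h \<in> hom C P Y \<and> h \<cdot>\<^bsub>C\<^esub> i = f \<and> h \<cdot>\<^bsub>C\<^esub> j = g)"

text \<open>\<open>is_pullback C f g p q\<close>: the square \<open>f \<cdot> p = g \<cdot> q\<close> is cartesian, so that \<open>q\<close> is the base
  change of \<open>f\<close> along \<open>g\<close>.\<close>

definition is_pullback :: "('o, 'a) cat \<Rightarrow> 'a \<Rightarrow> 'a \<Rightarrow> 'a \<Rightarrow> 'a \<Rightarrow> bool" where
  "is_pullback C f g p q \<longleftrightarrow>
     (\<exists>X Y Z P.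
        f \<in> hom C X Z \<and> g \<in> hom C Y Z \<and> p \<in> hom C P X \<and> q \<in> hom C P Y \<and> f \<cdot>\<^bsub>C\<^esub> p = g \<cdot>\<^bsub>C\<^esub> q \<and>
        (\<forall>T. \<forall>a \<in> hom C T X. \<forall>b \<in> hom C T Y. f \<cdot>\<^bsub>C\<^esub> a = g \<cdot>\<^bsub>C\<^esub> b \<longrightarrow>
           (\<exists>!h. h \<in> hom C T P \<and> p \<cdot>\<^bsub>C\<^esub> h = a \<and> q \<cdot>\<^bsub>C\<^esub> h = b)))"

text \<open>\<open>is_pushout C f g i j\<close>: the square \<open>i \<cdot> f = j \<cdot> g\<close> is cocartesian, so that \<open>j\<close> is the cobase
  change of \<open>f\<close> along \<open>g\<close>.\<close>

definition is_pushout :: "('o, 'a) cat \<Rightarrow> 'a \<Rightarrow> 'a \<Rightarrow> 'a \<Rightarrow> 'a \<Rightarrow> bool" where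
  "is_pushout C f g i j \<longleftrightarrow>
     (\<exists>X Y Z P.
        f \<in> hom C Z X \<and> g \<in> hom C Z Y \<and> i \<in> hom C X P \<and> j \<in> hom C Y P \<and> i \<cdot>\<^bsub>C\<^esub> f = j \<cdot>\<^bsub>C\<^esub> g \<and>
        (\<forall>T. \<forall>a \<in> hom C X T. \<forall>b \<in> hom C Y T. a \<cdot>\<^bsub>C\<^esub> f = b \<cdot>\<^bsub>C\<^esub> g \<longrightarrow>
           (\<exists>!h. h \<in> hom C P T \<and> h \<cdot>\<^bsub>C\<^esub> i = a \<and> h \<cdot>\<^bsub>C\<^esub> j = b)))"


section \<open>Model categories\<close>

text \<open>These are Quillen's axioms M0--M5 from \<^emph>\<open>Homotopical Algebra\<close>, I.1. Neither closure under
  retracts (a \<^emph>\<open>closed\<close> model category), nor functorial factorizations, nor infinite limits and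
  colimits are required, so the model categories of later authors are particular cases.\<close>

locale model_category = category C
  for C :: "('o, 'a) cat" (structure)
    and W :: "'a set" and Fib :: "'a set" and Cof :: "'a set" +
  assumes W_Arr: "W \<subseteq> Arr C" and Fib_Arr: "Fib \<subseteq> Arr C" and Cof_Arr: "Cof \<subseteq> Arr C"
    and M0_limits: "has_finite_limits C"
    and M0_colimits: "has_finite_colimits C"
    and M1_lifting:
      "\<lbrakk>i \<in> Cof; p \<in> Fib; i \<in> W \<or> p \<in> W;
        f \<in> hom C (Dom C i) (Dom C p); g \<in> hom C (Cod C i) (Cod C p); p \<cdot> f = g \<cdot> i\<rbrakk>
       \<Longrightarrow> \<exists>h \<in> hom C (Cod C i) (Dom C p). h \<cdot> i = f \<and> p \<cdot> h = g"
    and M2_trivial_cofibration: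
      "f \<in> hom C A B \<Longrightarrow> \<exists>X. \<exists>i \<in> hom C A X \<inter> Cof \<inter> W. \<exists>p \<in> hom C X B \<inter> Fib. f = p \<cdot> i"
    and M2_trivial_fibration:
      "f \<in> hom C A B \<Longrightarrow> \<exists>X. \<exists>i \<in> hom C A X \<inter> Cof. \<exists>p \<in> hom C X B \<inter> Fib \<inter> W. f = p \<cdot> i"
    and M3_Fib_iso: "is_iso C f \<Longrightarrow> f \<in> Fib"
    and M3_Fib_Comp: "\<lbrakk>f \<in> Fib; g \<in> Fib; Cod C f = Dom C g\<rbrakk> \<Longrightarrow> g \<cdot> f \<in> Fib"
    and M3_Fib_base_change: "\<lbrakk>f \<in> Fib; is_pullback C f g p q\<rbrakk> \<Longrightarrow> q \<in> Fib"
    and M3_Cof_iso: "is_iso C f \<Longrightarrow> f \<in> Cof"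
    and M3_Cof_Comp: "\<lbrakk>f \<in> Cof; g \<in> Cof; Cod C f = Dom C g\<rbrakk> \<Longrightarrow> g \<cdot> f \<in> Cof"
    and M3_Cof_cobase_change: "\<lbrakk>f \<in> Cof; is_pushout C f g i j\<rbrakk> \<Longrightarrow> j \<in> Cof"
    and M4_base_change: "\<lbrakk>f \<in> Fib \<inter> W; is_pullback C f g p q\<rbrakk> \<Longrightarrow> q \<in> W"
    and M4_cobase_change: "\<lbrakk>f \<in> Cof \<inter> W; is_pushout C f g i j\<rbrakk> \<Longrightarrow> j \<in> W"
    and M5_W_iso: "is_iso C f \<Longrightarrow> f \<in> W"
    and M5_Comp: "\<lbrakk>f \<in> hom C A B; g \<in> hom C B D; f \<in> W; g \<in> W\<rbrakk> \<Longrightarrow> g \<cdot> f \<in> W"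
    and M5_left: "\<lbrakk>f \<in> hom C A B; g \<in> hom C B D; f \<in> W; g \<cdot> f \<in> W\<rbrakk> \<Longrightarrow> g \<in> W"
    and M5_right: "\<lbrakk>f \<in> hom C A B; g \<in> hom C B D; g \<in> W; g \<cdot> f \<in> W\<rbrakk> \<Longrightarrow> f \<in> W"

definition is_cofibrant :: "('o, 'a) cat \<Rightarrow> 'a set \<Rightarrow> 'o \<Rightarrow> bool" where
  "is_cofibrant C Cof A \<longleftrightarrow> (\<exists>I. is_initial C I \<and> (\<exists>f \<in> hom C I A. f \<in> Cof))"

definition is_fibrant :: "('o, 'a) cat \<Rightarrow> 'a set \<Rightarrow> 'o \<Rightarrow> bool" where
  "is_fibrant C Fib A \<longleftrightarrow> (\<exists>T. is_terminal C T \<and> (\<exists>f \<in> hom C A T. f \<in> Fib))"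

definition fibrant_cofibrant_subcategory ::
    "('o, 'a) cat \<Rightarrow> 'a set \<Rightarrow> 'a set \<Rightarrow> ('o, 'a) cat" where
  "fibrant_cofibrant_subcategory C Fib Cof =
     full_subcategory C {A \<in> Obj C. is_fibrant C Fib A \<and> is_cofibrant C Cof A}"


section \<open>The two homotopy relations\<close>

text \<open>In a model category, whether the arrow \<open>d\<close> induced by \<open>d0\<close> and \<open>d1\<close> is a cofibration does not
  depend on the coproduct of \<open>A\<close> with itself that is used, because cofibrations contain the
  isomorphisms and are closed under composition.\<close>

definition left_homotopic :: "('o, 'a) cat \<Rightarrow> 'a set \<Rightarrow> 'a set \<Rightarrow> 'a \<Rightarrow> 'a \<Rightarrow> bool" where
  "left_homotopic C W Cof f g \<longleftrightarrow>
     (\<exists>A B. f \<in> hom C A B \<and> g \<in> hom C A B \<and>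
       (\<exists>AI. \<exists>d0 \<in> hom C A AI. \<exists>d1 \<in> hom C A AI. \<exists>s \<in> hom C AI A. \<exists>h \<in> hom C AI B.
          s \<cdot>\<^bsub>C\<^esub> d0 = Ident C A \<and> s \<cdot>\<^bsub>C\<^esub> d1 = Ident C A \<and> h \<cdot>\<^bsub>C\<^esub> d0 = f \<and> h \<cdot>\<^bsub>C\<^esub> d1 = g \<and> s \<in> W \<and>
          (\<exists>P i0 i1. is_coproduct C A A P i0 i1 \<and>
             (\<exists>d \<in> hom C P AI. d \<cdot>\<^bsub>C\<^esub> i0 = d0 \<and> d \<cdot>\<^bsub>C\<^esub> i1 = d1 \<and> d \<in> Cof))))"

text \<open>A family of equivalence relations on the hom-sets is encoded as one equivalence relation on
  the set of all arrows that relates only parallel arrows.\<close>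

definition is_congruence :: "('o, 'a) cat \<Rightarrow> ('a \<times> 'a) set \<Rightarrow> bool" where
  "is_congruence C E \<longleftrightarrow>
     equiv (Arr C) E \<and>
     (\<forall>(f, g) \<in> E. Dom C f = Dom C g \<and> Cod C f = Cod C g) \<and>
     (\<forall>(f, g) \<in> E. \<forall>u \<in> Arr C. \<forall>v \<in> Arr C. Cod C u = Dom C f \<and> Dom C v = Cod C f \<longrightarrow>
        (v \<cdot>\<^bsub>C\<^esub> f \<cdot>\<^bsub>C\<^esub> u, v \<cdot>\<^bsub>C\<^esub> g \<cdot>\<^bsub>C\<^esub> u) \<in> E)"

definition least_congruence :: "('o, 'a) cat \<Rightarrow> ('a \<times> 'a) set \<Rightarrow> ('a \<times> 'a) set" where
  "least_congruence C R = \<Inter>{E. is_congruence C E \<and> R \<subseteq> E}"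

definition R_left :: "('o, 'a) cat \<Rightarrow> 'a set \<Rightarrow> ('a \<times> 'a) set" where
  "R_left C W =
     {(f, g). \<exists>A B X. f \<in> hom C A B \<and> g \<in> hom C A B \<and>
        (\<exists>s \<in> hom C B X. s \<in> W \<and> s \<cdot>\<^bsub>C\<^esub> f = s \<cdot>\<^bsub>C\<^esub> g)}"

definition sim_left :: "('o, 'a) cat \<Rightarrow> 'a set \<Rightarrow> ('a \<times> 'a) set" where
  "sim_left C W = least_congruence C (R_left C W)"

lemma is_congruence_parallel:
  assumes "category C"
  shows "is_congruence C {(f, g). \<exists>A B. f \<in> hom C A B \<and> g \<in> hom C A B}"
proof -
  have comp: "v \<cdot>\<^bsub>C\<^esub> f \<cdot>\<^bsub>C\<^esub> u \<in> hom C (Dom C u) (Cod C v)"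
    if "f \<in> Arr C" "u \<in> Arr C" "v \<in> Arr C" "Cod C u = Dom C f" "Dom C v = Cod C f" for f u v
    using that category.Comp_in_hom[OF assms, of u _ "Dom C f" "v \<cdot>\<^bsub>C\<^esub> f"]
      category.Comp_in_hom[OF assms, of f "Dom C f" "Cod C f" v]
    by (auto simp: hom_def)
  show ?thesis
    unfolding is_congruence_def
  proof (intro conjI)
    show "equiv (Arr C) {(f, g). \<exists>A B. f \<in> hom C A B \<and> g \<in> hom C A B}"
      by (rule equivI) (auto simp: refl_on_def sym_on_def trans_on_def hom_def)
  qed (use comp in \<open>auto simp: hom_def\<close>)
qed

lemma is_congruence_least_congruence:
  assumes "category C" and "R \<subseteq> {(f, g). \<exists>A B. f \<in> hom C A B \<and> g \<in> hom C A B}"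
  shows "is_congruence C (least_congruence C R)"
proof -
  define K where "K = {E. is_congruence C E \<and> R \<subseteq> E}"
  define L where "L = \<Inter>K"
  have ne: "{(f, g). \<exists>A B. f \<in> hom C A B \<and> g \<in> hom C A B} \<in> K"
    unfolding K_def using assms is_congruence_parallel by blast
  have K: "equiv (Arr C) E" if "E \<in> K" for E
    using that by (simp add: K_def is_congruence_def)
  have parallel: "\<exists>A B. f \<in> hom C A B \<and> g \<in> hom C A B" if "(f, g) \<in> L" for f g
    using that ne unfolding L_def by blast
  have "equiv (Arr C) L"
  proof (rule equivI)
    show "L \<subseteq> Arr C \<times> Arr C"
      using parallel by (fastforce simp: hom_def)
    show "refl_on (Arr C) L"
      unfolding refl_on_def L_def using K by (auto simp: equiv_def refl_on_def)
    show "sym L"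
    proof (rule symI)
      fix f g assume "(f, g) \<in> L"
      then show "(g, f) \<in> L"
        unfolding L_def using K by (blast elim: equivE dest: symD)
    qed
    show "trans L"
    proof (rule transI)
      fix f g h assume "(f, g) \<in> L" "(g, h) \<in> L"
      then show "(f, h) \<in> L"
        unfolding L_def using K by (blast elim: equivE dest: transD)
    qed
  qed
  moreover have "(v \<cdot>\<^bsub>C\<^esub> f \<cdot>\<^bsub>C\<^esub> u, v \<cdot>\<^bsub>C\<^esub> g \<cdot>\<^bsub>C\<^esub> u) \<in> L"
    if "(f, g) \<in> L" "u \<in> Arr C" "v \<in> Arr C" "Cod C u = Dom C f" "Dom C v = Cod C f" for f g u v
    unfolding L_def
  proof (rule InterI)
    fix E assume E: "E \<in> K"
    then have "(f, g) \<in> E"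
      using that(1) by (auto simp: L_def)
    with E that(2-) show "(v \<cdot>\<^bsub>C\<^esub> f \<cdot>\<^bsub>C\<^esub> u, v \<cdot>\<^bsub>C\<^esub> g \<cdot>\<^bsub>C\<^esub> u) \<in> E"
      unfolding K_def is_congruence_def by blast
  qed
  moreover have "Dom C f = Dom C g \<and> Cod C f = Cod C g" if "(f, g) \<in> L" for f g
    using parallel[OF that] by (auto simp: hom_def)
  ultimately have "is_congruence C L"
    unfolding is_congruence_def by blast
  then show ?thesis
    by (simp add: least_congruence_def L_def K_def)
qed

end

theory Submission
  imports Defs
begin

text \<open>Two facts give the equivalence.

  A left homotopy between arrows of \<open>\<C>\<^sub>f\<^sub>c\<close> can be moved into \<open>\<C>\<^sub>f\<^sub>c\<close>. A cylinder \<open>X\<close> of a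
  cofibrant object is cofibrant, and a fibrant replacement \<open>j : X \<rightarrow> Y\<close> by a trivial cofibration
  remains cofibrant; both the projection \<open>\<sigma>\<close> and the homotopy \<open>h\<close> extend along \<open>j\<close>, because their
  targets are fibrant. The extended projection is a weak equivalence of \<open>\<C>\<^sub>f\<^sub>c\<close> that identifies the
  two ends of the cylinder, so these ends are \<open>R\<^sub>\<ell>\<close>-related, and composing them with the extended
  homotopy gives the two given arrows. Hence any congruence that contains \<open>R\<^sub>\<ell>\<close> contains left
  homotopy (\<open>left_homotopic_factors_through_weak_equivalence\<close>).

  Conversely, left homotopy is itself a congruence on \<open>\<C>\<^sub>f\<^sub>c\<close> that contains \<open>R\<^sub>\<ell>\<close>. Most of
  the homotopies needed for this come from one remark: arrows identified by a trivial fibration are left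
  homotopic, by lifting along \<open>A \<amalg> A \<rightarrow> A \<times> I\<close>
  (\<open>left_homotopic_if_trivial_fibration_identifies\<close>). It covers \<open>R\<^sub>\<ell>\<close>, since a weak equivalence with
  fibrant source is a trivial fibration after a trivial cofibration that has a retraction, and it
  covers precomposition, since a homotopy into a fibrant object can be carried by a cylinder whose
  projection is a trivial fibration.

  Transitivity is the remaining point. It is proved by a double homotopy
  (\<open>left_homotopic_trans\<close>): one of the two left homotopies is turned into a right homotopy, and both
  are then the given sides of a square whose filling is a lifting problem against the trivial
  fibration \<open>B\<^sup>I \<rightarrow> B\<close>. This uses path objects; they are the cylinders of the opposite category,
  which is again a model category, so every fact about cylinders has a dual.\<close>

section \<open>Duality\<close>

lemma opposite_opposite [simp]: "opposite (opposite C) = (C :: ('o, 'a) cat)"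
  by (simp add: opposite_def)

lemma opposite_simps [simp]:
  "Obj (opposite C) = Obj C" "Arr (opposite C) = Arr C" "Dom (opposite C) = Cod C"
  "Cod (opposite C) = Dom C" "Ident (opposite C) = Ident C"
  "g \<cdot>\<^bsub>opposite C\<^esub> f = f \<cdot>\<^bsub>C\<^esub> g"
  by (simp_all add: opposite_def)

lemma is_iso_opposite [simp]: "is_iso (opposite C) f \<longleftrightarrow> is_iso C f"
  by (auto simp: is_iso_def)

lemma is_pullback_opposite: "is_pullback (opposite C) f g p q \<longleftrightarrow> is_pushout C f g p q"
  by (simp add: is_pullback_def is_pushout_def)

lemma is_pushout_opposite: "is_pushout (opposite C) f g p q \<longleftrightarrow> is_pullback C f g p q"
  by (simp add: is_pullback_def is_pushout_def)

lemma is_cofibrant_opposite: "is_cofibrant (opposite C) Fib A \<longleftrightarrow> is_fibrant C Fib A"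
  by (simp add: is_cofibrant_def is_fibrant_def is_initial_def is_terminal_def)

lemma model_category_opposite:
  assumes "model_category C W Fib Cof"
  shows "model_category (opposite C) W Cof Fib"
proof -
  interpret model_category C W Fib Cof by fact
  interpret op: category "opposite C" by (rule category_opposite) (rule category_axioms)
  show ?thesis
  proof
    show "has_finite_limits (opposite C)"
      using M0_colimits by (simp add: has_finite_colimits_def)
    show "has_finite_colimits (opposite C)"
      using M0_limits by (simp add: has_finite_colimits_def)
  next
    fix i p f g
    assume "i \<in> Fib" "p \<in> Cof" "i \<in> W \<or> p \<in> W"
      "f \<in> hom (opposite C) (Dom (opposite C) i) (Dom (opposite C) p)"
      "g \<in> hom (opposite C) (Cod (opposite C) i) (Cod (opposite C) p)"
      "p \<cdot>\<^bsub>opposite C\<^esub> f = g \<cdot>\<^bsub>opposite C\<^esub> i"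
    then show "\<exists>h \<in> hom (opposite C) (Cod (opposite C) i) (Dom (opposite C) p).
        h \<cdot>\<^bsub>opposite C\<^esub> i = f \<and> p \<cdot>\<^bsub>opposite C\<^esub> h = g"
      using M1_lifting[of p i g f] by auto
  next
    fix f A B
    assume "f \<in> hom (opposite C) A B"
    then have f: "f \<in> hom C B A" by simp
    show "\<exists>X. \<exists>i\<in>hom (opposite C) A X \<inter> Fib \<inter> W. \<exists>p\<in>hom (opposite C) X B \<inter> Cof.
        f = p \<cdot>\<^bsub>opposite C\<^esub> i"
      using M2_trivial_fibration[OF f] by simp blast
    show "\<exists>X. \<exists>i\<in>hom (opposite C) A X \<inter> Fib. \<exists>p\<in>hom (opposite C) X B \<inter> Cof \<inter> W.
        f = p \<cdot>\<^bsub>opposite C\<^esub> i"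
      using M2_trivial_cofibration[OF f] by simp blast
  next
    fix f g p q
    show "f \<in> Cof \<Longrightarrow> is_pullback (opposite C) f g p q \<Longrightarrow> q \<in> Cof"
      by (simp add: is_pullback_opposite M3_Cof_cobase_change)
    show "f \<in> Fib \<Longrightarrow> is_pushout (opposite C) f g p q \<Longrightarrow> q \<in> Fib"
      by (simp add: is_pushout_opposite M3_Fib_base_change)
    show "f \<in> Cof \<inter> W \<Longrightarrow> is_pullback (opposite C) f g p q \<Longrightarrow> q \<in> W"
      unfolding is_pullback_opposite by (rule M4_cobase_change)
    show "f \<in> Fib \<inter> W \<Longrightarrow> is_pushout (opposite C) f g p q \<Longrightarrow> q \<in> W"
      unfolding is_pushout_opposite by (rule M4_base_change)
  next
    fix f g A B D
    assume "f \<in> hom (opposite C) A B" "g \<in> hom (opposite C) B D"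
    then have fg: "g \<in> hom C D B" "f \<in> hom C B A" by simp_all
    show "f \<in> W \<Longrightarrow> g \<in> W \<Longrightarrow> g \<cdot>\<^bsub>opposite C\<^esub> f \<in> W"
      using M5_Comp[OF fg] by simp
    show "f \<in> W \<Longrightarrow> g \<cdot>\<^bsub>opposite C\<^esub> f \<in> W \<Longrightarrow> g \<in> W"
      using M5_right[OF fg] by simp
    show "g \<in> W \<Longrightarrow> g \<cdot>\<^bsub>opposite C\<^esub> f \<in> W \<Longrightarrow> f \<in> W"
      using M5_left[OF fg] by simp
  qed (simp_all add: W_Arr Fib_Arr Cof_Arr M3_Fib_iso M3_Cof_iso M3_Fib_Comp M3_Cof_Comp M5_W_iso)
qed


section \<open>Coproducts\<close>

lemma is_coproduct_commute: "is_coproduct C A B P i j \<Longrightarrow> is_coproduct C B A P j i"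
  unfolding is_coproduct_def by (metis (no_types, lifting))

context category
begin

lemma Comp_Comp_eq:
  assumes "f \<in> hom C A B" "g \<in> hom C B D" "h \<in> hom C D E" "g \<cdot> f = k"
  shows "(h \<cdot> g) \<cdot> f = h \<cdot> k"
  using Comp_assoc[OF assms(1-3)] assms(4) by simp

lemma Comp_Comp_Ident:
  assumes "f \<in> hom C A B" "g \<in> hom C B A" "h \<in> hom C A E" "g \<cdot> f = Ident C A"
  shows "(h \<cdot> g) \<cdot> f = h"
  using Comp_Comp_eq[OF assms] Comp_Ident assms(3) by simp

lemma hom_Obj: "f \<in> hom C A B \<Longrightarrow> A \<in> Obj C" "f \<in> hom C A B \<Longrightarrow> B \<in> Obj C"
  using Dom_in_Obj Cod_in_Obj by (auto simp: hom_def)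

lemma is_iso_Ident: "A \<in> Obj C \<Longrightarrow> is_iso C (Ident C A)"
  using Ident_in_hom[of A] Comp_Ident[OF Ident_in_hom[of A]] unfolding is_iso_def hom_def by auto

text \<open>The colimit of a diagram on the discrete category with objects \<open>0\<close> and \<open>1\<close>.\<close>

lemma coproduct_exists:
  assumes "has_finite_colimits C" and A: "A \<in> Obj C" and B: "B \<in> Obj C"
  obtains P i j where "is_coproduct C A B P i j"
proof -
  define J :: "(nat, nat) cat" where
    "J = \<lparr>Obj = {0, 1}, Arr = {0, 1}, Dom = id, Cod = id, Ident = id, Comp = (\<lambda>g f. f)\<rparr>"
  define Fo where "Fo = (\<lambda>j :: nat. if j = 0 then A else B)"
  define Fa where "Fa = (\<lambda>j. Ident C (Fo j))"
  have Fo: "Fo j \<in> Obj C" for j using A B by (simp add: Fo_def)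
  have "category J"
    by unfold_locales (auto simp: J_def hom_def)
  moreover have "is_functor J (opposite C) Fo Fa"
    using Fo Ident_in_hom Comp_Ident[OF Ident_in_hom]
    by (auto simp: is_functor_def J_def Fa_def)
  moreover have "finite (Obj J)" "finite (Arr J)" by (simp_all add: J_def)
  ultimately obtain P p where lim: "is_limit J (opposite C) Fo Fa P p"
    using assms(1) unfolding has_finite_colimits_def has_finite_limits_def by blast
  have "is_coproduct C A B P (p 0) (p 1)"
    unfolding is_coproduct_def
  proof (intro conjI allI ballI)
    show "p 0 \<in> hom C A P" "p 1 \<in> hom C B P"
      using lim by (auto simp: is_limit_def is_cone_def J_def Fo_def)
  next
    fix Y f g
    assume fg: "f \<in> hom C A Y" "g \<in> hom C B Y"
    let ?q = "\<lambda>j :: nat. if j = 0 then f else g"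
    have "is_cone J (opposite C) Fo Fa Y ?q"
      using fg hom_Obj Comp_Ident by (auto simp: is_cone_def J_def Fo_def Fa_def)
    with lim have "\<exists>!h. h \<in> hom (opposite C) Y P \<and>
        (\<forall>j \<in> Obj J. p j \<cdot>\<^bsub>opposite C\<^esub> h = ?q j)"
      unfolding is_limit_def by blast
    then show "\<exists>!h. h \<in> hom C P Y \<and> h \<cdot> p 0 = f \<and> h \<cdot> p 1 = g"
      by (simp add: J_def)
  qed
  then show thesis ..
qed

lemma coproduct_copair:
  assumes "is_coproduct C A B P i j" "f \<in> hom C A Y" "g \<in> hom C B Y"
  obtains h where "h \<in> hom C P Y" "h \<cdot> i = f" "h \<cdot> j = g"
  using assms unfolding is_coproduct_def by blast

lemma coproduct_ext:
  assumes cop: "is_coproduct C A B P i j" and h: "h \<in> hom C P Y" "k \<in> hom C P Y"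
    and eq: "h \<cdot> i = k \<cdot> i" "h \<cdot> j = k \<cdot> j"
  shows "h = k"
proof -
  have "i \<in> hom C A P" "j \<in> hom C B P" using cop by (auto simp: is_coproduct_def)
  then have "k \<cdot> i \<in> hom C A Y" "k \<cdot> j \<in> hom C B Y" using Comp_in_hom h by blast+
  then have "\<exists>!h. h \<in> hom C P Y \<and> h \<cdot> i = k \<cdot> i \<and> h \<cdot> j = k \<cdot> j"
    using cop unfolding is_coproduct_def by blast
  then show ?thesis using h eq by blast
qed

lemma coproduct_is_pushout_of_initial:
  assumes cop: "is_coproduct C A B P i j" and I: "is_initial C I"
    and f: "f \<in> hom C I A" and g: "g \<in> hom C I B"
  shows "is_pushout C f g i j"
proof -
  have ij: "i \<in> hom C A P" "j \<in> hom C B P" using cop by (auto simp: is_coproduct_def)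
  have "i \<cdot> f \<in> hom C I P" "j \<cdot> g \<in> hom C I P" using ij f g Comp_in_hom by blast+
  then have "i \<cdot> f = j \<cdot> g" using I hom_Obj unfolding is_initial_def by blast
  moreover have "\<exists>!h. h \<in> hom C P T \<and> h \<cdot> i = a \<and> h \<cdot> j = b"
    if "a \<in> hom C A T" "b \<in> hom C B T" for T a b
    using cop that unfolding is_coproduct_def by blast
  ultimately show ?thesis
    unfolding is_pushout_def using f g ij by blast
qed

end


section \<open>Cylinders and path objects\<close>

text \<open>The data \<open>\<partial>\<^sub>0, \<partial>\<^sub>1, \<sigma>\<close> of a left homotopy are separated from the arrow \<open>h\<close> so that they can
  be dualized. In the opposite category, \<open>d0\<close> and \<open>d1\<close> are the two evaluations of a path object and \<open>s\<close> is the inclusion of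
  constant paths.\<close>

definition is_cylinder ::
    "('o, 'a) cat \<Rightarrow> 'a set \<Rightarrow> 'a set \<Rightarrow> 'o \<Rightarrow> 'o \<Rightarrow> 'a \<Rightarrow> 'a \<Rightarrow> 'a \<Rightarrow> bool" where
  "is_cylinder C W Cof A X d0 d1 s \<longleftrightarrow>
     d0 \<in> hom C A X \<and> d1 \<in> hom C A X \<and> s \<in> hom C X A \<and> s \<in> W \<and>
     s \<cdot>\<^bsub>C\<^esub> d0 = Ident C A \<and> s \<cdot>\<^bsub>C\<^esub> d1 = Ident C A \<and>
     (\<exists>P i0 i1. is_coproduct C A A P i0 i1 \<and>
        (\<exists>d \<in> hom C P X. d \<cdot>\<^bsub>C\<^esub> i0 = d0 \<and> d \<cdot>\<^bsub>C\<^esub> i1 = d1 \<and> d \<in> Cof))"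

abbreviation is_path_object ::
    "('o, 'a) cat \<Rightarrow> 'a set \<Rightarrow> 'a set \<Rightarrow> 'o \<Rightarrow> 'o \<Rightarrow> 'a \<Rightarrow> 'a \<Rightarrow> 'a \<Rightarrow> bool" where
  "is_path_object C \<equiv> is_cylinder (opposite C)"

lemma left_homotopic_iff_cylinder:
  "left_homotopic C W Cof f g \<longleftrightarrow>
     (\<exists>A B X d0 d1 s. \<exists>h \<in> hom C X B. is_cylinder C W Cof A X d0 d1 s \<and>
        f \<in> hom C A B \<and> g \<in> hom C A B \<and> h \<cdot>\<^bsub>C\<^esub> d0 = f \<and> h \<cdot>\<^bsub>C\<^esub> d1 = g)"
  unfolding left_homotopic_def is_cylinder_def by blast

lemma is_cylinder_commute:
  "is_cylinder C W Cof A X d0 d1 s \<Longrightarrow> is_cylinder C W Cof A X d1 d0 s"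
  unfolding is_cylinder_def using is_coproduct_commute[of C A A] by metis

lemma is_cylinder_hom:
  assumes "is_cylinder C W Cof A X d0 d1 s"
  shows "d0 \<in> hom C A X" "d1 \<in> hom C A X" "s \<in> hom C X A"
    "s \<cdot>\<^bsub>C\<^esub> d0 = Ident C A" "s \<cdot>\<^bsub>C\<^esub> d1 = Ident C A" "s \<in> W"
  using assms by (simp_all add: is_cylinder_def)

context model_category
begin

lemma Ident_in_W: "A \<in> Obj C \<Longrightarrow> Ident C A \<in> W"
  by (simp add: M5_W_iso is_iso_Ident)

lemma Ident_in_Fib: "A \<in> Obj C \<Longrightarrow> Ident C A \<in> Fib"
  by (simp add: M3_Fib_iso is_iso_Ident)

lemma lifting:
  assumes "i \<in> hom C A B" "p \<in> hom C X Y" "i \<in> Cof" "p \<in> Fib" "i \<in> W \<or> p \<in> W"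
    "f \<in> hom C A X" "g \<in> hom C B Y" "p \<cdot> f = g \<cdot> i"
  obtains h where "h \<in> hom C B X" "h \<cdot> i = f" "p \<cdot> h = g"
  using M1_lifting[of i p f g] assms by (auto simp: hom_def)

text \<open>The inclusion is the cobase change of \<open>0 \<rightarrow> A\<close> along \<open>0 \<rightarrow> B\<close>.\<close>

lemma coproduct_inclusion_Cof:
  assumes "is_cofibrant C Cof A" "is_cofibrant C Cof B" "is_coproduct C A B P i j"
  shows "j \<in> Cof"
proof -
  obtain I f where f: "is_initial C I" "f \<in> hom C I A" "f \<in> Cof"
    using assms(1) unfolding is_cofibrant_def by blast
  have "B \<in> Obj C"
    using assms(3) hom_Obj unfolding is_coproduct_def by blast
  then obtain g where "g \<in> hom C I B"
    using f(1) unfolding is_initial_def by blast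
  then have "is_pushout C f g i j"
    using coproduct_is_pushout_of_initial assms(3) f by blast
  then show ?thesis using M3_Cof_cobase_change f(3) by blast
qed

text \<open>Factor the codiagonal \<open>A \<amalg> A \<rightarrow> A\<close> into a cofibration and a trivial fibration.\<close>

lemma cylinder_exists:
  assumes A: "A \<in> Obj C"
  obtains X d0 d1 s where "is_cylinder C W Cof A X d0 d1 s"
proof -
  obtain P i0 i1 where P: "is_coproduct C A A P i0 i1"
    using coproduct_exists M0_colimits A by blast
  then have i: "i0 \<in> hom C A P" "i1 \<in> hom C A P" by (auto simp: is_coproduct_def)
  obtain c where c: "c \<in> hom C P A" "c \<cdot> i0 = Ident C A" "c \<cdot> i1 = Ident C A"
    using coproduct_copair[OF P] Ident_in_hom[OF A] by blast
  obtain X d s where d: "d \<in> hom C P X" "d \<in> Cof" and s: "s \<in> hom C X A" "s \<in> W"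
    and eq: "c = s \<cdot> d"
    using M2_trivial_fibration[OF c(1)] by blast
  have "is_cylinder C W Cof A X (d \<cdot> i0) (d \<cdot> i1) s"
    unfolding is_cylinder_def
    using Comp_in_hom i d s P c Comp_assoc[OF _ d(1) s(1), symmetric] eq by metis
  then show thesis ..
qed

text \<open>The lifting axiom for \<open>A \<amalg> A \<rightarrow> X\<close> against a trivial fibration, stated on the two ends: a
  homotopy in the base lifts to one with prescribed ends. Its dual fills a path object over the
  target of a trivial cofibration.\<close>

lemma cylinder_lifting:
  assumes cyl: "is_cylinder C W Cof A X d0 d1 s"
    and p: "p \<in> hom C Y Z" "p \<in> Fib" "p \<in> W"
    and a: "a \<in> hom C A Y" and b: "b \<in> hom C A Y" and k: "k \<in> hom C X Z"
    and eq: "p \<cdot> a = k \<cdot> d0" "p \<cdot> b = k \<cdot> d1"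
  obtains h where "h \<in> hom C X Y" "h \<cdot> d0 = a" "h \<cdot> d1 = b" "p \<cdot> h = k"
proof -
  obtain P i0 i1 d where P: "is_coproduct C A A P i0 i1"
    and d: "d \<in> hom C P X" "d \<cdot> i0 = d0" "d \<cdot> i1 = d1" "d \<in> Cof"
    using cyl unfolding is_cylinder_def by blast
  have i: "i0 \<in> hom C A P" "i1 \<in> hom C A P" using P by (auto simp: is_coproduct_def)
  obtain c where c: "c \<in> hom C P Y" "c \<cdot> i0 = a" "c \<cdot> i1 = b"
    using coproduct_copair[OF P a b] .
  have "(p \<cdot> c) \<cdot> i0 = (k \<cdot> d) \<cdot> i0" "(p \<cdot> c) \<cdot> i1 = (k \<cdot> d) \<cdot> i1"
    using Comp_assoc i c p(1) d k eq by metis+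
  then have "p \<cdot> c = k \<cdot> d"
    using coproduct_ext[OF P] Comp_in_hom c(1) p(1) d(1) k by blast
  then obtain h where h: "h \<in> hom C X Y" "h \<cdot> d = c" "p \<cdot> h = k"
    using lifting[OF d(1) p(1) d(4) p(2) _ c(1) k] p(3) by blast
  then have "h \<cdot> d0 = a" "h \<cdot> d1 = b"
    using Comp_assoc[OF _ d(1) h(1)] i c d by metis+
  then show thesis using that h by blast
qed

lemma cylinder_end_trivial_cofibration:
  assumes "is_cofibrant C Cof A" and cyl: "is_cylinder C W Cof A X d0 d1 s"
  shows "d0 \<in> Cof" "d0 \<in> W"
proof -
  obtain P i0 i1 d where P: "is_coproduct C A A P i0 i1"
    and d: "d \<in> hom C P X" "d \<cdot> i0 = d0" "d \<in> Cof"
    using cyl unfolding is_cylinder_def by blast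
  have "i0 \<in> hom C A P" using P by (auto simp: is_coproduct_def)
  moreover have "i0 \<in> Cof"
    using coproduct_inclusion_Cof[OF assms(1) assms(1) is_coproduct_commute[OF P]] .
  ultimately show "d0 \<in> Cof"
    using M3_Cof_Comp[of i0 d] d by (auto simp: hom_def)
  note c = is_cylinder_hom[OF cyl]
  show "d0 \<in> W"
    using M5_right[OF c(1,3,6)] c(4) Ident_in_W hom_Obj(1)[OF c(1)] by simp
qed

lemma cofibrant_Cof:
  assumes "is_cofibrant C Cof A" "i \<in> hom C A B" "i \<in> Cof"
  shows "is_cofibrant C Cof B"
proof -
  obtain I f where f: "is_initial C I" "f \<in> hom C I A" "f \<in> Cof"
    using assms(1) unfolding is_cofibrant_def by blast
  then have "i \<cdot> f \<in> hom C I B" "i \<cdot> f \<in> Cof"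
    using Comp_in_hom[OF f(2) assms(2)] M3_Cof_Comp[of f i] assms by (auto simp: hom_def)
  then show ?thesis using f(1) unfolding is_cofibrant_def by blast
qed

interpretation op: model_category "opposite C" W Cof Fib
  by (rule model_category_opposite) (rule model_category_axioms)

text \<open>The model structure on the opposite category turns the facts about cylinders into facts about
  path objects.\<close>

lemmas path_object_exists = op.cylinder_exists[simplified]
lemmas path_object_lifting = op.cylinder_lifting[simplified]
lemmas path_object_end_trivial_fibration =
  op.cylinder_end_trivial_cofibration[unfolded is_cofibrant_opposite]
lemmas is_path_object_hom = is_cylinder_hom[where C = "opposite C", simplified]

text \<open>Extending into \<open>B\<close> is a lifting problem against the fibration from \<open>B\<close> to a terminal object,
  over which the square commutes trivially.\<close>

lemma fibrant_extension:
  assumes B: "is_fibrant C Fib B" and j: "j \<in> hom C X Y" "j \<in> Cof" "j \<in> W"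
    and f: "f \<in> hom C X B"
  obtains h where "h \<in> hom C Y B" "h \<cdot> j = f"
proof -
  obtain T p where T: "is_terminal C T" and p: "p \<in> hom C B T" "p \<in> Fib"
    using B unfolding is_fibrant_def by blast
  obtain t where t: "t \<in> hom C Y T"
    using T hom_Obj(2)[OF j(1)] unfolding is_terminal_def by blast
  have "p \<cdot> f \<in> hom C X T" "t \<cdot> j \<in> hom C X T"
    using Comp_in_hom p(1) f t j(1) by blast+
  then have "p \<cdot> f = t \<cdot> j"
    using T hom_Obj(1)[OF j(1)] unfolding is_terminal_def by blast
  then show thesis
    using lifting[OF j(1) p(1) j(2) p(2) _ f t] j(3) that by blast
qed

lemma fibrant_replacement:
  assumes "X \<in> Obj C" and T: "is_terminal C T"
  obtains Y j where "is_fibrant C Fib Y" "j \<in> hom C X Y" "j \<in> Cof" "j \<in> W"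
proof -
  obtain t where "t \<in> hom C X T"
    using assms unfolding is_terminal_def by blast
  from M2_trivial_cofibration[OF this] T that show thesis
    unfolding is_fibrant_def by blast
qed


section \<open>Left homotopy\<close>

lemma left_homotopicE:
  assumes "left_homotopic C W Cof f g" and f: "f \<in> hom C A B"
  obtains X d0 d1 s h where "is_cylinder C W Cof A X d0 d1 s" "h \<in> hom C X B"
    "h \<cdot> d0 = f" "h \<cdot> d1 = g" "g \<in> hom C A B"
proof -
  obtain A' B' X d0 d1 s h where *: "is_cylinder C W Cof A' X d0 d1 s" "h \<in> hom C X B'"
    "f \<in> hom C A' B'" "g \<in> hom C A' B'" "h \<cdot> d0 = f" "h \<cdot> d1 = g"
    using assms(1) unfolding left_homotopic_iff_cylinder by blast
  moreover have "A' = A" "B' = B" using f *(3) by (auto simp: hom_def)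
  ultimately show thesis using that by blast
qed

lemma left_homotopicI:
  assumes "is_cylinder C W Cof A X d0 d1 s" "h \<in> hom C X B"
  shows "left_homotopic C W Cof (h \<cdot> d0) (h \<cdot> d1)"
  unfolding left_homotopic_iff_cylinder
  using assms Comp_in_hom is_cylinder_hom[OF assms(1)] by blast

lemma left_homotopic_postcompose:
  assumes "left_homotopic C W Cof f g" and f: "f \<in> hom C A B" and v: "v \<in> hom C B D"
  shows "left_homotopic C W Cof (v \<cdot> f) (v \<cdot> g)"
proof -
  obtain X d0 d1 s h where cyl: "is_cylinder C W Cof A X d0 d1 s" and h: "h \<in> hom C X B"
    "h \<cdot> d0 = f" "h \<cdot> d1 = g"
    using left_homotopicE assms(1) f by metis
  have "left_homotopic C W Cof ((v \<cdot> h) \<cdot> d0) ((v \<cdot> h) \<cdot> d1)"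
    using left_homotopicI[OF cyl] Comp_in_hom[OF h(1) v] by blast
  then show ?thesis
    using Comp_assoc[OF _ h(1) v] is_cylinder_hom(1,2)[OF cyl] h(2,3) by metis
qed

lemma left_homotopic_sym: "left_homotopic C W Cof f g \<Longrightarrow> left_homotopic C W Cof g f"
  unfolding left_homotopic_iff_cylinder using is_cylinder_commute[of C W Cof] by metis

text \<open>The constant homotopy at \<open>p \<cdot> a = p \<cdot> b\<close> lifts along \<open>p\<close> to a homotopy with ends \<open>a\<close> and
  \<open>b\<close>. This is the way in which the homotopies below are constructed without choosing a cylinder
  that is compatible with other data.\<close>

lemma left_homotopic_if_trivial_fibration_identifies:
  assumes a: "a \<in> hom C A X" and b: "b \<in> hom C A X"
    and p: "p \<in> hom C X Y" "p \<in> Fib" "p \<in> W" and eq: "p \<cdot> a = p \<cdot> b"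
  shows "left_homotopic C W Cof a b"
proof -
  obtain Z d0 d1 s where cyl: "is_cylinder C W Cof A Z d0 d1 s"
    using cylinder_exists hom_Obj(1)[OF a] by blast
  note c = is_cylinder_hom[OF cyl]
  have pa: "p \<cdot> a \<in> hom C A Y" using Comp_in_hom[OF a p(1)] .
  then have k: "(p \<cdot> a) \<cdot> s \<in> hom C Z Y" using Comp_in_hom[OF c(3)] by blast
  have "p \<cdot> a = ((p \<cdot> a) \<cdot> s) \<cdot> d0" "p \<cdot> b = ((p \<cdot> a) \<cdot> s) \<cdot> d1"
    using Comp_Comp_Ident[OF _ c(3) pa] c eq by simp_all
  then obtain h where "h \<in> hom C Z X" "h \<cdot> d0 = a" "h \<cdot> d1 = b"
    using cylinder_lifting[OF cyl p a b k] by blast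
  then show ?thesis using left_homotopicI[OF cyl] by blast
qed

lemma left_homotopic_refl: "f \<in> hom C A B \<Longrightarrow> left_homotopic C W Cof f f"
  using left_homotopic_if_trivial_fibration_identifies Ident_in_hom Ident_in_Fib Ident_in_W
    hom_Obj by blast

text \<open>A homotopy on \<open>A\<close> does not directly give one on \<open>A'\<close>, because cylinders are not functorial.
  But, \<open>B\<close> being fibrant, \<open>h\<close> extends along a trivial cofibration to an object \<open>Y\<close> that projects
  to \<open>A\<close> by a trivial fibration \<open>q\<close>; and \<open>q\<close> sends both ends of \<open>Y\<close>, composed with \<open>u\<close>, to \<open>u\<close>.\<close>

lemma left_homotopic_precompose:
  assumes fg: "left_homotopic C W Cof f g" and f: "f \<in> hom C A B"
    and B: "is_fibrant C Fib B" and u: "u \<in> hom C A' A"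
  shows "left_homotopic C W Cof (f \<cdot> u) (g \<cdot> u)"
proof -
  obtain X d0 d1 s h where cyl: "is_cylinder C W Cof A X d0 d1 s" and h: "h \<in> hom C X B"
    "h \<cdot> d0 = f" "h \<cdot> d1 = g"
    using left_homotopicE fg f by metis
  note c = is_cylinder_hom[OF cyl]
  obtain Y j q where j: "j \<in> hom C X Y" "j \<in> Cof" "j \<in> W" and q: "q \<in> hom C Y A" "q \<in> Fib"
    and s: "s = q \<cdot> j"
    using M2_trivial_cofibration[OF c(3)] by blast
  have "q \<in> W" using M5_left[OF j(1) q(1) j(3)] c(6) s by simp
  obtain k where k: "k \<in> hom C Y B" "k \<cdot> j = h"
    using fibrant_extension[OF B j h(1)] .
  have end_q: "q \<cdot> (j \<cdot> (d \<cdot> u)) = u"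
    and end_k: "k \<cdot> (j \<cdot> (d \<cdot> u)) = (h \<cdot> d) \<cdot> u"
    and end_hom: "j \<cdot> (d \<cdot> u) \<in> hom C A' Y"
    if d: "d \<in> hom C A X" "s \<cdot> d = Ident C A" for d
  proof -
    have du: "d \<cdot> u \<in> hom C A' X" using Comp_in_hom[OF u d(1)] .
    then show "j \<cdot> (d \<cdot> u) \<in> hom C A' Y" using Comp_in_hom[OF _ j(1)] by blast
    have "q \<cdot> (j \<cdot> (d \<cdot> u)) = s \<cdot> (d \<cdot> u)" using Comp_assoc[OF du j(1) q(1)] s by simp
    also have "\<dots> = u" using Comp_assoc[OF u d(1) c(3)] d(2) Ident_Comp[OF u] by simp
    finally show "q \<cdot> (j \<cdot> (d \<cdot> u)) = u" .
    show "k \<cdot> (j \<cdot> (d \<cdot> u)) = (h \<cdot> d) \<cdot> u"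
      using Comp_assoc[OF du j(1) k(1)] k(2) Comp_assoc[OF u d(1) h(1)] by simp
  qed
  have "left_homotopic C W Cof (j \<cdot> (d0 \<cdot> u)) (j \<cdot> (d1 \<cdot> u))"
    by (rule left_homotopic_if_trivial_fibration_identifies[where A = A', OF _ _ q \<open>q \<in> W\<close>])
      (simp_all add: end_hom end_q c)
  then have "left_homotopic C W Cof (k \<cdot> (j \<cdot> (d0 \<cdot> u))) (k \<cdot> (j \<cdot> (d1 \<cdot> u)))"
    using left_homotopic_postcompose end_hom c(1,4) k(1) by blast
  then show ?thesis using end_k c h by simp
qed

text \<open>Over the cylinder, lift the pair \<open>(f \<cdot> s, h)\<close> of arrows to \<open>B\<close> to an arrow to the path object
  that is constant at \<open>f\<close> on the end \<open>d0\<close>; this end is a trivial cofibration since \<open>A\<close> is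
  cofibrant. Restricted to the other end, the lift is a path from \<open>f\<close> to \<open>g\<close>.\<close>

lemma left_homotopic_imp_right_homotopy:
  assumes fg: "left_homotopic C W Cof f g" and f: "f \<in> hom C A B"
    and A: "is_cofibrant C Cof A" and path: "is_path_object C W Fib B PB p0 p1 w"
  obtains K where "K \<in> hom C A PB" "p0 \<cdot> K = f" "p1 \<cdot> K = g"
proof -
  obtain X d0 d1 s h where cyl: "is_cylinder C W Cof A X d0 d1 s" and h: "h \<in> hom C X B"
    "h \<cdot> d0 = f" "h \<cdot> d1 = g"
    using left_homotopicE fg f by metis
  note c = is_cylinder_hom[OF cyl] and p = is_path_object_hom[OF path]
  note d0 = cylinder_end_trivial_cofibration[OF A cyl]
  have fs: "f \<cdot> s \<in> hom C X B" using Comp_in_hom[OF c(3) f] .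
  have wf: "w \<cdot> f \<in> hom C A PB" using Comp_in_hom[OF f p(3)] .
  have fsd: "(f \<cdot> s) \<cdot> d = f" if "d \<in> hom C A X" "s \<cdot> d = Ident C A" for d
    using Comp_Comp_Ident[OF that(1) c(3) f that(2)] .
  have pwf: "p \<cdot> (w \<cdot> f) = f" if "p \<in> hom C PB B" "p \<cdot> w = Ident C B" for p
    using Comp_assoc[OF f p(3) that(1)] that(2) Ident_Comp[OF f] by simp
  have "(f \<cdot> s) \<cdot> d0 = p0 \<cdot> (w \<cdot> f)" "h \<cdot> d0 = p1 \<cdot> (w \<cdot> f)"
    using fsd pwf c p h by simp_all
  then obtain H where H: "H \<in> hom C X PB" "p0 \<cdot> H = f \<cdot> s" "p1 \<cdot> H = h"
    using path_object_lifting[OF path c(1) d0 fs h(1) wf] by blast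
  show thesis
  proof
    show "H \<cdot> d1 \<in> hom C A PB" using Comp_in_hom[OF c(2) H(1)] .
    show "p0 \<cdot> (H \<cdot> d1) = f"
      using Comp_assoc[OF c(2) H(1) p(1)] H(2) fsd[OF c(2,5)] by simp
    show "p1 \<cdot> (H \<cdot> d1) = g"
      using Comp_assoc[OF c(2) H(1) p(2)] H(3) h(3) by simp
  qed
qed

text \<open>A double homotopy \<open>G : X \<rightarrow> B\<^sup>I\<close>: its side under the evaluation \<open>p0\<close> is the left homotopy \<open>h\<close>
  from \<open>f\<close> to \<open>g\<close>, and its sides on the two ends of \<open>X\<close> are the constant path at \<open>f\<close> and a right
  homotopy \<open>K\<close> from \<open>g\<close> to \<open>k\<close>. The filling exists because \<open>p0\<close> is a trivial fibration, and its
  fourth side \<open>p1 \<cdot> G\<close> is a left homotopy from \<open>f\<close> to \<open>k\<close>. In this way two cylinders need not be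
  glued along a common end.\<close>

lemma left_homotopic_trans:
  assumes fg: "left_homotopic C W Cof f g" and gk: "left_homotopic C W Cof g k"
    and f: "f \<in> hom C A B" and A: "is_cofibrant C Cof A" and B: "is_fibrant C Fib B"
  shows "left_homotopic C W Cof f k"
proof -
  obtain X d0 d1 s h where cyl: "is_cylinder C W Cof A X d0 d1 s" and h: "h \<in> hom C X B"
    "h \<cdot> d0 = f" "h \<cdot> d1 = g" and g: "g \<in> hom C A B"
    using left_homotopicE fg f by metis
  obtain PB p0 p1 w where path: "is_path_object C W Fib B PB p0 p1 w"
    using path_object_exists hom_Obj(2)[OF f] by blast
  note p = is_path_object_hom[OF path]
  note p0 = path_object_end_trivial_fibration[OF B path]
  obtain K where K: "K \<in> hom C A PB" "p0 \<cdot> K = g" "p1 \<cdot> K = k"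
    using left_homotopic_imp_right_homotopy[OF gk g A path] .
  have wf: "w \<cdot> f \<in> hom C A PB" using Comp_in_hom[OF f p(3)] .
  have pwf: "p0 \<cdot> (w \<cdot> f) = f" "p1 \<cdot> (w \<cdot> f) = f"
    using Comp_assoc[OF f p(3) p(1)] Comp_assoc[OF f p(3) p(2)] p(4,5) Ident_Comp[OF f]
    by simp_all
  have "p0 \<cdot> (w \<cdot> f) = h \<cdot> d0" "p0 \<cdot> K = h \<cdot> d1" using pwf h K by simp_all
  then obtain G where G: "G \<in> hom C X PB" "G \<cdot> d0 = w \<cdot> f" "G \<cdot> d1 = K"
    using cylinder_lifting[OF cyl p(1) p0 wf K(1) h(1)] by blast
  have "left_homotopic C W Cof ((p1 \<cdot> G) \<cdot> d0) ((p1 \<cdot> G) \<cdot> d1)"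
    using left_homotopicI[OF cyl] Comp_in_hom[OF G(1) p(2)] by blast
  then show ?thesis
    using Comp_assoc[OF _ G(1) p(2)] is_cylinder_hom(1,2)[OF cyl] G pwf K(3) by simp
qed

text \<open>Write \<open>s\<close> as a trivial fibration \<open>p\<close> after a trivial cofibration \<open>i\<close>. Then \<open>i \<cdot> f\<close> and \<open>i \<cdot> g\<close>
  are identified by \<open>p\<close>, hence homotopic, and a retraction of \<open>i\<close> carries this homotopy back
  to \<open>B\<close>.\<close>

lemma left_homotopic_if_weak_equivalence_identifies:
  assumes f: "f \<in> hom C A B" and g: "g \<in> hom C A B" and B: "is_fibrant C Fib B"
    and s: "s \<in> hom C B X" "s \<in> W" and eq: "s \<cdot> f = s \<cdot> g"
  shows "left_homotopic C W Cof f g"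
proof -
  obtain Y i p where i: "i \<in> hom C B Y" "i \<in> Cof" "i \<in> W" and p: "p \<in> hom C Y X" "p \<in> Fib"
    and s_eq: "s = p \<cdot> i"
    using M2_trivial_cofibration[OF s(1)] by blast
  have "p \<in> W" using M5_left[OF i(1) p(1) i(3)] s(2) s_eq by simp
  obtain r where r: "r \<in> hom C Y B" "r \<cdot> i = Ident C B"
    using fibrant_extension[OF B i Ident_in_hom[OF hom_Obj(2)[OF f]]] .
  have "p \<cdot> (i \<cdot> f) = p \<cdot> (i \<cdot> g)"
    using Comp_assoc[OF f i(1) p(1)] Comp_assoc[OF g i(1) p(1)] eq s_eq by simp
  then have "left_homotopic C W Cof (i \<cdot> f) (i \<cdot> g)"
    using left_homotopic_if_trivial_fibration_identifies[OF _ _ p \<open>p \<in> W\<close>]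
      Comp_in_hom[OF f i(1)] Comp_in_hom[OF g i(1)] by blast
  then have "left_homotopic C W Cof (r \<cdot> (i \<cdot> f)) (r \<cdot> (i \<cdot> g))"
    using left_homotopic_postcompose Comp_in_hom[OF f i(1)] r(1) by blast
  then show ?thesis
    using Comp_assoc[OF f i(1) r(1)] Comp_assoc[OF g i(1) r(1)] r(2) Ident_Comp f g by simp
qed

text \<open>The middle object of a left homotopy can be taken fibrant and cofibrant: replace the cylinder
  fibrantly by a trivial cofibration \<open>j\<close> and extend \<open>s\<close> and \<open>h\<close> along \<open>j\<close> to the fibrant objects
  \<open>A\<close> and \<open>B\<close>.\<close>

lemma left_homotopic_factors_through_weak_equivalence:
  assumes fg: "left_homotopic C W Cof f g" and f: "f \<in> hom C A B"
    and A: "is_fibrant C Fib A" "is_cofibrant C Cof A" and B: "is_fibrant C Fib B"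
  obtains X d0 d1 s h where "is_fibrant C Fib X" "is_cofibrant C Cof X"
    "d0 \<in> hom C A X" "d1 \<in> hom C A X" "s \<in> hom C X A" "s \<in> W" "s \<cdot> d0 = s \<cdot> d1"
    "h \<in> hom C X B" "h \<cdot> d0 = f" "h \<cdot> d1 = g"
proof -
  obtain X d0 d1 s h where cyl: "is_cylinder C W Cof A X d0 d1 s" and h: "h \<in> hom C X B"
    "h \<cdot> d0 = f" "h \<cdot> d1 = g"
    using left_homotopicE fg f by metis
  note c = is_cylinder_hom[OF cyl]
  obtain T where "is_terminal C T"
    using B unfolding is_fibrant_def by blast
  then obtain Y j where Y: "is_fibrant C Fib Y" and j: "j \<in> hom C X Y" "j \<in> Cof" "j \<in> W"
    using fibrant_replacement hom_Obj(2)[OF c(1)] by metis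
  obtain s' where s': "s' \<in> hom C Y A" "s' \<cdot> j = s"
    using fibrant_extension[OF A(1) j c(3)] .
  obtain h' where h': "h' \<in> hom C Y B" "h' \<cdot> j = h"
    using fibrant_extension[OF B j h(1)] .
  show thesis
  proof
    show "is_fibrant C Fib Y" by fact
    show "is_cofibrant C Cof Y"
      using cofibrant_Cof A(2) c(1) j cylinder_end_trivial_cofibration[OF A(2) cyl] by blast
    show "j \<cdot> d0 \<in> hom C A Y" "j \<cdot> d1 \<in> hom C A Y"
      using Comp_in_hom c(1,2) j(1) by blast+
    show "s' \<in> hom C Y A" "h' \<in> hom C Y B" by fact+
    show "s' \<in> W" using M5_left[OF j(1) s'(1) j(3)] s'(2) c(6) by simp
    show "s' \<cdot> (j \<cdot> d0) = s' \<cdot> (j \<cdot> d1)"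
      using Comp_assoc[OF c(1) j(1) s'(1)] Comp_assoc[OF c(2) j(1) s'(1)] s'(2) c(4,5) by simp
    show "h' \<cdot> (j \<cdot> d0) = f" "h' \<cdot> (j \<cdot> d1) = g"
      using Comp_assoc[OF c(1) j(1) h'(1)] Comp_assoc[OF c(2) j(1) h'(1)] h'(2) h(2,3) by simp_all
  qed
qed

end


section \<open>The subcategory of fibrant-cofibrant objects\<close>

lemma hom_fibrant_cofibrant_subcategory:
  "f \<in> hom (fibrant_cofibrant_subcategory C Fib Cof) A B \<longleftrightarrow>
     f \<in> hom C A B \<and> A \<in> Obj C \<and> is_fibrant C Fib A \<and> is_cofibrant C Cof A \<and>
     B \<in> Obj C \<and> is_fibrant C Fib B \<and> is_cofibrant C Cof B"
  by (auto simp: hom_def fibrant_cofibrant_subcategory_def full_subcategory_def)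

lemma fibrant_cofibrant_subcategory_simps [simp]:
  "Dom (fibrant_cofibrant_subcategory C Fib Cof) = Dom C"
  "Cod (fibrant_cofibrant_subcategory C Fib Cof) = Cod C"
  "Ident (fibrant_cofibrant_subcategory C Fib Cof) = Ident C"
  "g \<cdot>\<^bsub>fibrant_cofibrant_subcategory C Fib Cof\<^esub> f = g \<cdot>\<^bsub>C\<^esub> f"
  by (simp_all add: fibrant_cofibrant_subcategory_def full_subcategory_def)

context model_category
begin

abbreviation FC where "FC \<equiv> fibrant_cofibrant_subcategory C Fib Cof"

lemma category_FC: "category FC"
  unfolding fibrant_cofibrant_subcategory_def
  by (rule category_full_subcategory) (rule category_axioms)

lemma is_congruence_Comp:
  assumes "is_congruence D E" "(f, g) \<in> E"
    and "f \<in> hom D A B" "u \<in> hom D A' A" "v \<in> hom D B B'"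
  shows "(v \<cdot>\<^bsub>D\<^esub> f \<cdot>\<^bsub>D\<^esub> u, v \<cdot>\<^bsub>D\<^esub> g \<cdot>\<^bsub>D\<^esub> u) \<in> E"
  using assms unfolding is_congruence_def hom_def by blast

lemma Arr_FC_iff: "f \<in> Arr FC \<longleftrightarrow> f \<in> hom FC (Dom C f) (Cod C f)"
  by (simp add: hom_def)

lemma left_homotopic_is_congruence:
  "is_congruence FC {(f, g). left_homotopic C W Cof f g \<and> (\<exists>A B. f \<in> hom FC A B \<and> g \<in> hom FC A B)}"
    (is "is_congruence _ ?E")
  unfolding is_congruence_def
proof (intro conjI)
  show "equiv (Arr FC) ?E"
  proof (rule equivI)
    show "?E \<subseteq> Arr FC \<times> Arr FC" by (auto simp: hom_def)
    show "refl_on (Arr FC) ?E"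
      unfolding refl_on_def using left_homotopic_refl Arr_FC_iff
      by (blast dest: hom_fibrant_cofibrant_subcategory[THEN iffD1])
    show "sym ?E" by (rule symI) (use left_homotopic_sym in blast)
    show "trans ?E"
    proof (rule transI)
      fix f g k
      assume "(f, g) \<in> ?E" "(g, k) \<in> ?E"
      then obtain A B A' B' where *: "left_homotopic C W Cof f g" "left_homotopic C W Cof g k"
        "f \<in> hom FC A B" "g \<in> hom FC A B" "g \<in> hom FC A' B'" "k \<in> hom FC A' B'"
        by blast
      moreover from this have "A' = A" "B' = B" by (auto simp: hom_def)
      moreover have "left_homotopic C W Cof f k"
        using left_homotopic_trans * by (auto simp: hom_fibrant_cofibrant_subcategory)
      ultimately show "(f, k) \<in> ?E" by blast
    qed
  qed
  show "\<forall>(f, g) \<in> ?E. Dom FC f = Dom FC g \<and> Cod FC f = Cod FC g"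
    by (auto simp: hom_def)
  have "(v \<cdot> f \<cdot> u, v \<cdot> g \<cdot> u) \<in> ?E"
    if fg: "left_homotopic C W Cof f g" "f \<in> hom FC A B" "g \<in> hom FC A B"
      and u: "u \<in> hom FC A' A" and v: "v \<in> hom FC B B'" for f g u v A B A' B'
  proof -
    have vf: "v \<cdot> f \<in> hom FC A B'" "v \<cdot> g \<in> hom FC A B'"
      using category.Comp_in_hom[OF category_FC] fg v by fastforce+
    then have "v \<cdot> f \<cdot> u \<in> hom FC A' B'" "v \<cdot> g \<cdot> u \<in> hom FC A' B'"
      using category.Comp_in_hom[OF category_FC u] by fastforce+
    moreover have "left_homotopic C W Cof (v \<cdot> f \<cdot> u) (v \<cdot> g \<cdot> u)"
      using left_homotopic_precompose left_homotopic_postcompose fg u v vf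
      unfolding hom_fibrant_cofibrant_subcategory by blast
    ultimately show ?thesis by blast
  qed
  then show "\<forall>(f, g) \<in> ?E. \<forall>u \<in> Arr FC. \<forall>v \<in> Arr FC.
      Cod FC u = Dom FC f \<and> Dom FC v = Cod FC f \<longrightarrow>
      (v \<cdot>\<^bsub>FC\<^esub> f \<cdot>\<^bsub>FC\<^esub> u, v \<cdot>\<^bsub>FC\<^esub> g \<cdot>\<^bsub>FC\<^esub> u) \<in> ?E"
    by (simp add: hom_def) blast
qed

lemma sim_left_imp_left_homotopic:
  assumes "(f, g) \<in> sim_left FC (W \<inter> Arr FC)"
  shows "left_homotopic C W Cof f g"
proof -
  let ?E = "{(f, g). left_homotopic C W Cof f g \<and> (\<exists>A B. f \<in> hom FC A B \<and> g \<in> hom FC A B)}"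
  have "R_left FC (W \<inter> Arr FC) \<subseteq> ?E"
    unfolding R_left_def
    by (auto simp: hom_fibrant_cofibrant_subcategory
        intro: left_homotopic_if_weak_equivalence_identifies)
  then show ?thesis
    using assms left_homotopic_is_congruence unfolding sim_left_def least_congruence_def by blast
qed

lemma left_homotopic_imp_sim_left:
  assumes fg: "left_homotopic C W Cof f g" and f: "f \<in> hom FC A B"
  shows "(f, g) \<in> sim_left FC (W \<inter> Arr FC)"
proof -
  have f': "f \<in> hom C A B" and A: "A \<in> Obj C" "is_fibrant C Fib A" "is_cofibrant C Cof A"
    and B: "B \<in> Obj C" "is_fibrant C Fib B" "is_cofibrant C Cof B"
    using f by (auto simp: hom_fibrant_cofibrant_subcategory)
  obtain X d0 d1 s h where X: "is_fibrant C Fib X" "is_cofibrant C Cof X"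
    and d: "d0 \<in> hom C A X" "d1 \<in> hom C A X" and s: "s \<in> hom C X A" "s \<in> W" "s \<cdot> d0 = s \<cdot> d1"
    and h: "h \<in> hom C X B" "h \<cdot> d0 = f" "h \<cdot> d1 = g"
    using left_homotopic_factors_through_weak_equivalence[OF fg f' A(2,3) B(2)] .
  have FC: "d0 \<in> hom FC A X" "d1 \<in> hom FC A X" "s \<in> hom FC X A" "h \<in> hom FC X B"
    "Ident C A \<in> hom FC A A"
    using X A B d s h hom_Obj Ident_in_hom by (auto simp: hom_fibrant_cofibrant_subcategory)
  have "(d0, d1) \<in> R_left FC (W \<inter> Arr FC)"
    unfolding R_left_def using FC s by (auto simp: hom_def)
  then have "(h \<cdot> d0 \<cdot> Ident C A, h \<cdot> d1 \<cdot> Ident C A) \<in> E"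
    if "is_congruence FC E" "R_left FC (W \<inter> Arr FC) \<subseteq> E" for E
    using is_congruence_Comp[OF that(1) _ FC(1,5,4)] that(2) by auto
  \<comment> \<open>Congruences are closed under composition on both sides at once, whence the identity.\<close>
  moreover have "h \<cdot> d0 \<cdot> Ident C A = f" "h \<cdot> d1 \<cdot> Ident C A = g"
    using Comp_Ident Comp_in_hom d h by metis+
  ultimately show ?thesis
    unfolding sim_left_def least_congruence_def by auto
qed

end

theorem proposition3p4p3:
  fixes C :: "('o, 'a) cat" and W Fib Cof :: "'a set" and A B :: 'o and f g :: 'a
  assumes "model_category C W Fib Cof"
    and "f \<in> hom (fibrant_cofibrant_subcategory C Fib Cof) A B"
    and "g \<in> hom (fibrant_cofibrant_subcategory C Fib Cof) A B"
  shows "left_homotopic C W Cof f g \<longleftrightarrow>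
    (f, g) \<in> sim_left (fibrant_cofibrant_subcategory C Fib Cof)
               (W \<inter> Arr (fibrant_cofibrant_subcategory C Fib Cof))"
  using model_category.left_homotopic_imp_sim_left[OF assms(1)]
    model_category.sim_left_imp_left_homotopic[OF assms(1)] assms(2) by blast

end
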